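(* Let $N\ge 1$ be an integer, let $a_m(x)=\sum_{i=0}^m a_{m,i}x^i$, $m=1,\ldots,N$, be polynomials with complex coefficients, and let $L=\sum_{i=1}^N a_i(x)\frac{d^i}{dx^i}$. For $n\ge 0$ put $\lambda_n=\sum_{i=1}^{\min\{n,N\}}\binom{n}{i}\,i!\,a_{i,i}$ (so $\lambda_0=0$), and assume that the numbers $\lambda_n$, $n=0,1,2,\ldots$, are pairwise distinct. For each $n$ let $P_n(x)=\sum_{i=0}^n b_{n,i}x^i$, $b_{n,n}=1$, be the unique monic polynomial of degree $n$ with $LP_n=\lambda_nP_n$. Then for each $n\ge 1$ $$b_{n,i}=\sum_{(i_1,\ldots,i_k)\in E_n^{(i)}}\ \prod_{s=1}^k\frac{\delta^{(i_s)}_{i+i_1+\cdots+i_s}}{\lambda_n-\lambda_{i+i_1+\cdots+i_{s-1}}},\qquad i=0,1,\ldots,n-1,$$ where $E_n^{(i)}$ is the set of all finite ordered tuples $(i_1,\ldots,i_k)$ of positive integers, of any length $k\ge 1$, with $i_1+\cdots+i_k=n-i$, and where $i+i_1+\cdots+i_{s-1}$ is understood to be $i$ when $s=1$.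
   Context: Conventions: $a_{0,0}=0$ and $a_{i,j}=0$ whenever $i>N$. For $n\ge 0$ and $0\le k\le n$, $$\delta_n^{(k)}=\sum_{i=k}^{n}\binom{n}{i}\,i!\,a_{i,i-k}.$$ Under the distinctness assumption on the $\lambda_n$, for every $n$ there is exactly one monic polynomial $P_n$ of degree $n$ with $LP_n=\lambda_nP_n$. *)

theory Defs
  imports Complex_Main "HOL-Computational_Algebra.Polynomial"
begin

definition diff_op :: "nat \<Rightarrow> (nat \<Rightarrow> complex poly) \<Rightarrow> complex poly \<Rightarrow> complex poly" where
  "diff_op N a p = (\<Sum>i=1..N. a i * (pderiv ^^ i) p)"

text \<open>The index conventions: the entries with index 0 or beyond \<open>N\<close> vanish, whatever the junk
  values \<open>a 0\<close> and \<open>a i\<close> for \<open>i > N\<close> are.\<close>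

definition op_coeff :: "nat \<Rightarrow> (nat \<Rightarrow> complex poly) \<Rightarrow> nat \<Rightarrow> nat \<Rightarrow> complex" where
  "op_coeff N a i j = (if 1 \<le> i \<and> i \<le> N then coeff (a i) j else 0)"

definition eigval :: "nat \<Rightarrow> (nat \<Rightarrow> complex poly) \<Rightarrow> nat \<Rightarrow> complex" where
  "eigval N a n = (\<Sum>i=1..min n N. of_nat (n choose i) * fact i * op_coeff N a i i)"

text \<open>The upper index \<open>k\<close> comes before the lower index \<open>n\<close>.\<close>

definition delta :: "nat \<Rightarrow> (nat \<Rightarrow> complex poly) \<Rightarrow> nat \<Rightarrow> nat \<Rightarrow> complex" where
  "delta N a k n = (\<Sum>i=k..n. of_nat (n choose i) * fact i * op_coeff N a i (i - k))"

definition is_monic_eigenpoly ::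
    "nat \<Rightarrow> (nat \<Rightarrow> complex poly) \<Rightarrow> nat \<Rightarrow> complex poly \<Rightarrow> bool" where
  "is_monic_eigenpoly N a n p \<longleftrightarrow>
     degree p = n \<and> lead_coeff p = 1 \<and> diff_op N a p = smult (eigval N a n) p"

definition compositions :: "nat \<Rightarrow> nat \<Rightarrow> nat list set" where
  "compositions n i = {ks. ks \<noteq> [] \<and> (\<forall>k\<in>set ks. 0 < k) \<and> sum_list ks = n - i}"

lemma finite_compositions: "finite (compositions n i)"
proof (rule finite_subset)
  have len: "length ks \<le> sum_list ks" if "\<forall>k\<in>set ks. 0 < k" for ks :: "nat list"
    using that by (induction ks) auto
  show "compositions n i \<subseteq> {ks. set ks \<subseteq> {..n - i} \<and> length ks \<le> n - i}"
    using len member_le_sum_list by (fastforce simp: compositions_def)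
qed (rule finite_lists_length_le, simp)

text \<open>The polynomials \<open>P\<^sub>n\<close> exist and are unique: \<open>diff_op\<close> is triangular with respect to the degree,
  with the eigenvalues on the diagonal.\<close>

lemma coeff_diff_op_top:
  assumes "\<And>m. m \<in> {1..N} \<Longrightarrow> degree (a m) \<le> m" and d: "degree p \<le> d"
  shows "degree (diff_op N a p) \<le> d"
    and "coeff (diff_op N a p) d = eigval N a d * coeff p d"
proof -
  have deg: "degree ((pderiv ^^ i) p) = degree p - i" for i
    by (induction i) (simp_all add: degree_pderiv)
  have zero: "(pderiv ^^ i) p = 0" if "i > d" for i
  proof (rule poly_eqI)
    fix k
    show "coeff ((pderiv ^^ i) p) k = coeff 0 k"
      using that d by (simp add: coeff_higher_pderiv coeff_eq_0)
  qed
  have le: "degree (a i * (pderiv ^^ i) p) \<le> d" if i: "i \<in> {1..N}" for i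
  proof (cases "i > d")
    case False
    then show ?thesis
      using degree_mult_le[of "a i" "(pderiv ^^ i) p"] assms(1)[OF i] d deg[of i] by linarith
  qed (simp add: zero)
  show "degree (diff_op N a p) \<le> d"
    unfolding diff_op_def by (rule degree_sum_le) (use le in auto)
  have top: "coeff (a i * (pderiv ^^ i) p) d = of_nat (d choose i) * fact i * coeff (a i) i * coeff p d"
    if i: "i \<in> {1..N}" for i
  proof (cases "i > d")
    case False
    have "coeff (a i * (pderiv ^^ i) p) d
        = (\<Sum>j\<le>d. coeff (a i) j * coeff ((pderiv ^^ i) p) (d - j))"
      by (simp add: coeff_mult)
    also have "\<dots> = (\<Sum>j\<in>{i}. coeff (a i) j * coeff ((pderiv ^^ i) p) (d - j))"
    proof (rule sum.mono_neutral_right)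
      show "\<forall>j\<in>{..d} - {i}. coeff (a i) j * coeff ((pderiv ^^ i) p) (d - j) = 0"
      proof
        fix j assume j: "j \<in> {..d} - {i}"
        show "coeff (a i) j * coeff ((pderiv ^^ i) p) (d - j) = 0"
        proof (cases "j > i")
          case True
          then show ?thesis using assms(1)[OF i] by (simp add: coeff_eq_0)
        next
          case False
          then have "d < d - j + i" using j by auto
          then show ?thesis using d by (simp add: coeff_higher_pderiv coeff_eq_0)
        qed
      qed
    qed (use False in auto)
    also have "\<dots> = coeff (a i) i * (pochhammer (of_nat (Suc (d - i))) i * coeff p d)"
      using False by (simp add: coeff_higher_pderiv)
    also have "pochhammer (of_nat (Suc (d - i))) i = (of_nat (d choose i) * fact i :: complex)"
      using False by (simp add: binomial_gbinomial gbinomial_pochhammer' of_nat_diff algebra_simps)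
    finally show ?thesis by (simp add: mult_ac)
  qed (simp add: zero binomial_eq_0)
  have "eigval N a d = (\<Sum>i=1..N. of_nat (d choose i) * fact i * coeff (a i) i)"
    unfolding eigval_def by (rule sum.mono_neutral_cong_left) (auto simp: op_coeff_def binomial_eq_0)
  then show "coeff (diff_op N a p) d = eigval N a d * coeff p d"
    unfolding diff_op_def coeff_sum by (simp add: top sum_distrib_right)
qed

lemma diff_op_add: "diff_op N a (p + q) = diff_op N a p + diff_op N a q"
proof -
  have "(pderiv ^^ i) (p + q) = (pderiv ^^ i) p + (pderiv ^^ i) q" for i
    by (induction i) (simp_all add: pderiv_add)
  then show ?thesis by (simp add: diff_op_def distrib_left sum.distrib)
qed

lemma diff_op_diff: "diff_op N a (p - q) = diff_op N a p - diff_op N a q"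
  using diff_op_add[of N a "p - q" q] by (simp add: algebra_simps)

lemma ex1_monic_eigenpoly:
  assumes a: "\<And>m. m \<in> {1..N} \<Longrightarrow> degree (a m) \<le> m" and inj: "inj (eigval N a)"
  shows "\<exists>!p. is_monic_eigenpoly N a n p"
proof -
  define T where "T p = diff_op N a p - smult (eigval N a n) p" for p
  have T_add: "T (p + q) = T p + T q" for p q
    by (simp add: T_def diff_op_add smult_add_right)
  have T_diff: "T (p - q) = T p - T q" for p q
    by (simp add: T_def diff_op_diff smult_diff_right)
  have T_deg: "degree (T p) \<le> d"
    and T_top: "coeff (T p) d = (eigval N a d - eigval N a n) * coeff p d"
    if "degree p \<le> d" for p d
    using coeff_diff_op_top[OF a that] that
    by (auto simp: T_def algebra_simps intro!: degree_diff_le order_trans[OF degree_smult_le])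
  have vanish: "\<forall>j\<ge>d. coeff q j = 0" if "degree q \<le> d" "coeff q d = 0" for q :: "complex poly" and d
    using that by (metis coeff_eq_0 le_eq_less_or_eq order_le_less_trans)
  have bound: "degree q \<le> d" if "\<forall>j\<ge>Suc d. coeff q j = 0" for q :: "complex poly" and d
    using that by (simp add: degree_le)
  have solve: "\<exists>p. (\<forall>j\<ge>d. coeff p j = 0) \<and> T p = q"
    if "d \<le> n" "\<forall>j\<ge>d. coeff q j = 0" for d q
    using that
  proof (induction d arbitrary: q)
    case 0
    then have "q = 0" by (auto intro: poly_eqI)
    then show ?case by (intro exI[of _ 0]) (simp add: T_def diff_op_def higher_pderiv_0)
  next
    case (Suc d)
    define c where "c = coeff q d / (eigval N a d - eigval N a n)"
    have ne: "eigval N a d - eigval N a n \<noteq> 0"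
      using inj Suc.prems(1) by (auto dest: injD)
    have "degree (monom c d) \<le> d" by (rule degree_monom_le)
    then have "degree (q - T (monom c d)) \<le> d" "coeff (q - T (monom c d)) d = 0"
      using T_deg T_top bound[OF Suc.prems(2)] ne by (auto simp: c_def intro: degree_diff_le)
    from vanish[OF this] obtain p where p: "\<forall>j\<ge>d. coeff p j = 0" "T p = q - T (monom c d)"
      using Suc.IH Suc.prems(1) by (meson Suc_leD)
    then show ?case
      by (intro exI[of _ "p + monom c d"]) (simp add: T_add)
  qed
  have eig: "is_monic_eigenpoly N a n p \<longleftrightarrow> degree p = n \<and> lead_coeff p = 1 \<and> T p = 0" for p
    by (simp add: is_monic_eigenpoly_def T_def)
  show ?thesis
  proof (rule ex_ex1I)
    have "degree (T (monom 1 n)) \<le> n" "coeff (T (monom 1 n)) n = 0"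
      using T_deg[of "monom 1 n" n] T_top[of "monom 1 n" n] degree_monom_le[of "1 :: complex" n]
      by auto
    then have "\<forall>j\<ge>n. coeff (- T (monom 1 n)) j = 0" using vanish by simp
    from solve[OF order_refl this] obtain p
      where p: "\<forall>j\<ge>n. coeff p j = 0" "T p = - T (monom 1 n)" by blast
    have "degree (p + monom 1 n) \<le> n" by (rule degree_le) (use p in auto)
    moreover have c: "coeff (p + monom 1 n) n = 1" using p by simp
    then have "n \<le> degree (p + monom 1 n)" by (intro le_degree) simp
    ultimately have "degree (p + monom 1 n) = n" by simp
    with c p(2) show "\<exists>p. is_monic_eigenpoly N a n p"
      by (intro exI[of _ "p + monom 1 n"]) (simp add: eig T_add)
  next
    fix p q assume "is_monic_eigenpoly N a n p" "is_monic_eigenpoly N a n q"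
    then have p: "degree p = n" "coeff p n = 1" "T p = 0" and q: "degree q = n" "coeff q n = 1" "T q = 0"
      by (auto simp: eig)
    show "p = q"
    proof (rule ccontr)
      assume "p \<noteq> q"
      then have lc: "lead_coeff (p - q) \<noteq> 0"
        using leading_coeff_0_iff[of "p - q"] by simp
      then have "degree (p - q) \<noteq> n" using p(2) q(2) by auto
      then have "eigval N a (degree (p - q)) \<noteq> eigval N a n" using inj by (auto dest: injD)
      then show False using T_top[of "p - q" "degree (p - q)"] T_diff[of p q] p(3) q(3) lc by simp
    qed
  qed
qed

end

theory Submission
  imports Defs
begin

text \<open>Applied to \<open>x\<^sup>l\<close>, the operator \<open>L\<close> produces only powers \<open>x\<^sup>i\<close> with \<open>i \<le> l\<close>, and the
  coefficient of \<open>x\<^sup>i\<close> is the number \<open>\<delta>\<close> with upper index \<open>l - i\<close> and lower index \<open>l\<close>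
  (\<open>coeff_diff_op\<close>). For \<open>l = i\<close> this number is the eigenvalue \<open>\<lambda>\<^sub>i\<close>. Comparing the coefficients
  of \<open>x\<^sup>i\<close> in \<open>L P\<^sub>n = \<lambda>\<^sub>n P\<^sub>n\<close> and dividing by \<open>\<lambda>\<^sub>n - \<lambda>\<^sub>i \<noteq> 0\<close> therefore expresses \<open>b\<^sub>n\<^sub>,\<^sub>i\<close> as a
  linear combination of the higher coefficients \<open>b\<^sub>n\<^sub>,\<^sub>i\<^sub>+\<^sub>k\<close>, \<open>1 \<le> k \<le> n - i\<close>, with the weight
  \<open>\<delta>\<close> over \<open>\<lambda>\<^sub>n - \<lambda>\<^sub>i\<close> on the step from \<open>i\<close> to \<open>i + k\<close>
  (\<open>coeff_eigenpoly_recurrence\<close>).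

  Unfolding this recurrence until the index reaches \<open>n\<close>, where \<open>b\<^sub>n\<^sub>,\<^sub>n = 1\<close>, gives one summand for
  each way of climbing from \<open>i\<close> to \<open>n\<close> in positive steps, namely the product of the weights of
  its steps. The sequences of steps are the compositions of \<open>n - i\<close>
  (\<open>recurrence_solution\<close>).\<close>

section \<open>Summation over compositions\<close>

text \<open>In contrast to \<open>compositions\<close>, the empty list is a composition of \<open>0\<close> here; it is the base
  case of the recursion on the first part.\<close>

definition compositions0 :: "nat \<Rightarrow> nat list set" where
  "compositions0 m = {ks. (\<forall>k\<in>set ks. 0 < k) \<and> sum_list ks = m}"

lemma compositions0_0: "compositions0 0 = {[]}"
proof -
  have "ks = []" if "\<forall>k\<in>set ks. 0 < k" "sum_list ks = 0" for ks :: "nat list"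
    using that by (cases ks) auto
  then show ?thesis by (auto simp: compositions0_def)
qed

lemma compositions_eq_compositions0: "i < n \<Longrightarrow> compositions n i = compositions0 (n - i)"
  by (auto simp: compositions_def compositions0_def)

lemma finite_compositions0: "finite (compositions0 m)"
  using finite_compositions[of m 0] compositions_eq_compositions0[of 0 m]
  by (cases "m = 0") (simp_all add: compositions0_0)

lemma compositions0_by_first_part:
  assumes "0 < m"
  shows "compositions0 m = (\<Union>k\<in>{1..m}. (#) k ` compositions0 (m - k))"
proof (rule set_eqI)
  fix ks
  show "ks \<in> compositions0 m \<longleftrightarrow> ks \<in> (\<Union>k\<in>{1..m}. (#) k ` compositions0 (m - k))"
    using assms by (cases ks) (auto simp: compositions0_def image_iff)
qed

lemma sum_compositions0_by_first_part:
  fixes f :: "nat list \<Rightarrow> 'a::comm_monoid_add"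
  assumes "0 < m"
  shows "(\<Sum>ks\<in>compositions0 m. f ks) = (\<Sum>k=1..m. \<Sum>ks\<in>compositions0 (m - k). f (k # ks))"
proof -
  have "(\<Sum>ks\<in>compositions0 m. f ks) = (\<Sum>k=1..m. \<Sum>ks\<in>(#) k ` compositions0 (m - k). f ks)"
    unfolding compositions0_by_first_part[OF assms]
    by (rule sum.UNION_disjoint) (auto simp: finite_compositions0)
  also have "\<dots> = (\<Sum>k=1..m. \<Sum>ks\<in>compositions0 (m - k). f (k # ks))"
    by (rule sum.cong[OF refl]) (simp add: sum.reindex)
  finally show ?thesis .
qed

text \<open>A composition of \<open>n - i\<close> is a path from \<open>i\<close> to \<open>n\<close>, where \<open>w j k\<close> is the weight of the step
  from \<open>j\<close> to \<open>j + k\<close>. Splitting off the first step turns the recurrence at \<open>i\<close> into the path sums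
  that start at the higher points \<open>i + k\<close>.\<close>

lemma recurrence_solution:
  fixes b :: "nat \<Rightarrow> 'a::comm_semiring_1" and w :: "nat \<Rightarrow> nat \<Rightarrow> 'a"
  assumes top: "b n = 1"
    and rec: "\<And>i. i < n \<Longrightarrow> b i = (\<Sum>k=1..n - i. w i k * b (i + k))"
    and "i \<le> n"
  shows "b i = (\<Sum>ks\<in>compositions0 (n - i). \<Prod>s<length ks. w (i + sum_list (take s ks)) (ks ! s))"
  using \<open>i \<le> n\<close>
proof (induction "n - i" arbitrary: i rule: less_induct)
  case less
  let ?path = "\<lambda>i ks. \<Prod>s<length ks. w (i + sum_list (take s ks)) (ks ! s)"
  show ?case
  proof (cases "i = n")
    case True
    then show ?thesis by (simp add: top compositions0_0)
  next
    case False
    with less.prems have i: "i < n" by simp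
    have first_step: "?path i (k # ks) = w i k * ?path (i + k) ks" for k ks
      by (simp add: prod.lessThan_Suc_shift add.assoc del: prod.lessThan_Suc)
    have "b i = (\<Sum>k=1..n - i. w i k * b (i + k))"
      using rec[OF i] .
    also have "\<dots> = (\<Sum>k=1..n - i. \<Sum>ks\<in>compositions0 (n - i - k). ?path i (k # ks))"
    proof (rule sum.cong[OF refl])
      fix k assume k: "k \<in> {1..n - i}"
      then have "b (i + k) = (\<Sum>ks\<in>compositions0 (n - (i + k)). ?path (i + k) ks)"
        using i by (intro less.hyps) auto
      then show "w i k * b (i + k) = (\<Sum>ks\<in>compositions0 (n - i - k). ?path i (k # ks))"
        by (simp only: first_step sum_distrib_left diff_diff_left)
    qed
    also have "\<dots> = (\<Sum>ks\<in>compositions0 (n - i). ?path i ks)"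
      using i by (simp add: sum_compositions0_by_first_part del: length_Cons)
    finally show ?thesis .
  qed
qed

section \<open>The coefficients of the image of a polynomial\<close>

lemma pochhammer_eq_choose_fact:
  assumes "m \<le> l"
  shows "pochhammer (of_nat (Suc (l - m))) m = (of_nat (l choose m) * fact m :: 'a::field_char_0)"
  using assms by (simp add: binomial_gbinomial gbinomial_pochhammer' of_nat_diff algebra_simps)

text \<open>The power \<open>x\<^sup>l\<close> contributes to \<open>x\<^sup>i\<close> through the coefficient of \<open>c\<close> at \<open>m + i - l\<close>, which
  must be an index between \<open>0\<close> and \<open>m\<close>. The lower bound is the condition \<open>l - i \<le> m\<close>. The upper
  bound amounts to \<open>i \<le> l\<close>, and without it the truncated difference \<open>l - i\<close> would be wrong.\<close>

lemma coeff_mult_higher_pderiv: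
  fixes c p :: "'a::field_char_0 poly"
  assumes c: "degree c \<le> m" and p: "degree p \<le> n"
  shows "coeff (c * (pderiv ^^ m) p) i =
    (\<Sum>l=i..n. (if l - i \<le> m then of_nat (l choose m) * fact m * coeff c (m - (l - i)) else 0)
       * coeff p l)"
proof -
  let ?g = "\<lambda>l. of_nat (l choose m) * fact m * coeff c (m + i - l) * coeff p l"
  have "coeff (c * (pderiv ^^ m) p) i = (\<Sum>j\<le>i. coeff c j * coeff ((pderiv ^^ m) p) (i - j))"
    by (simp add: coeff_mult)
  also have "\<dots> = (\<Sum>l=m..m + i. ?g l)"
  proof (rule sum.reindex_bij_witness[of _ "\<lambda>l. m + i - l" "\<lambda>j. m + i - j"])
    fix j assume j: "j \<in> {..i}"
    then have "m \<le> m + i - j" "m + i - j - m = i - j" by auto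
    then have "pochhammer (of_nat (Suc (i - j))) m
        = (of_nat (m + i - j choose m) * fact m :: 'a)"
      using pochhammer_eq_choose_fact[of m "m + i - j"] by simp
    with j show "?g (m + i - j) = coeff c j * coeff ((pderiv ^^ m) p) (i - j)"
      by (simp add: coeff_higher_pderiv mult_ac add.commute)
  qed auto
  \<comment> \<open>Below \<open>m\<close> the binomial coefficient vanishes, below \<open>i\<close> the coefficient of \<open>c\<close>, and above
    \<open>n\<close> the coefficient of \<open>p\<close>.\<close>
  also have "\<dots> = (\<Sum>l\<in>{i..n} \<inter> {..m + i}. ?g l)"
    using c p by (intro sum.mono_neutral_cong) (auto simp: coeff_eq_0 binomial_eq_0 not_le)
  also have "\<dots> = (\<Sum>l=i..n. (if l - i \<le> m
      then of_nat (l choose m) * fact m * coeff c (m - (l - i)) else 0) * coeff p l)"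
    by (rule sum.mono_neutral_cong_left) auto
  finally show ?thesis .
qed

text \<open>The sum defining \<open>delta\<close> runs over all orders up to \<open>n\<close>, the operator has the orders from
  \<open>1\<close> to \<open>N\<close>; the orders in only one of the two ranges contribute zero, because of
  \<open>op_coeff\<close> or because of the binomial coefficient.\<close>

lemma delta_eq_sum_orders:
  "delta N a k n =
    (\<Sum>m=1..N. if k \<le> m then of_nat (n choose m) * fact m * coeff (a m) (m - k) else 0)"
proof -
  have "delta N a k n = (\<Sum>m\<in>{k..n} \<inter> {1..N}. of_nat (n choose m) * fact m * coeff (a m) (m - k))"
    unfolding delta_def by (rule sum.mono_neutral_cong_right) (auto simp: op_coeff_def)
  also have "\<dots> = (\<Sum>m=1..N. if k \<le> m
      then of_nat (n choose m) * fact m * coeff (a m) (m - k) else 0)"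
    by (rule sum.mono_neutral_cong_left) (auto simp: binomial_eq_0 not_le)
  finally show ?thesis .
qed

lemma coeff_diff_op:
  assumes a: "\<And>m. m \<in> {1..N} \<Longrightarrow> degree (a m) \<le> m" and p: "degree p \<le> n"
  shows "coeff (diff_op N a p) i = (\<Sum>l=i..n. delta N a (l - i) l * coeff p l)"
proof -
  have "coeff (diff_op N a p) i = (\<Sum>m=1..N. coeff (a m * (pderiv ^^ m) p) i)"
    by (simp add: diff_op_def coeff_sum)
  also have "\<dots> = (\<Sum>m=1..N. \<Sum>l=i..n. (if l - i \<le> m
      then of_nat (l choose m) * fact m * coeff (a m) (m - (l - i)) else 0) * coeff p l)"
    using a p by (intro sum.cong refl coeff_mult_higher_pderiv) auto
  also have "\<dots> = (\<Sum>l=i..n. delta N a (l - i) l * coeff p l)"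
    unfolding delta_eq_sum_orders sum_distrib_right by (rule sum.swap)
  finally show ?thesis .
qed

lemma delta_0_eq_eigval: "delta N a 0 n = eigval N a n"
  unfolding delta_def eigval_def
  by (rule sum.mono_neutral_cong_right) (auto simp: op_coeff_def)

section \<open>The coefficients of the eigenpolynomials\<close>

lemma coeff_eigenpoly_recurrence:
  assumes a: "\<And>m. m \<in> {1..N} \<Longrightarrow> degree (a m) \<le> m"
    and inj: "inj (eigval N a)"
    and p: "is_monic_eigenpoly N a n p"
    and i: "i < n"
  shows "coeff p i =
    (\<Sum>k=1..n - i. delta N a k (i + k) / (eigval N a n - eigval N a i) * coeff p (i + k))"
proof -
  from p have deg: "degree p \<le> n" and eig: "diff_op N a p = smult (eigval N a n) p"
    by (auto simp: is_monic_eigenpoly_def)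
  have ne: "eigval N a n - eigval N a i \<noteq> 0"
    using inj i by (auto dest: injD)
  have "eigval N a n * coeff p i = (\<Sum>l=i..n. delta N a (l - i) l * coeff p l)"
    using coeff_diff_op[where N = N and a = a, OF a deg] by (simp add: eig)
  also have "\<dots> = eigval N a i * coeff p i + (\<Sum>l=Suc i..n. delta N a (l - i) l * coeff p l)"
    using i by (simp add: sum.atLeast_Suc_atMost delta_0_eq_eigval)
  also have "(\<Sum>l=Suc i..n. delta N a (l - i) l * coeff p l)
      = (\<Sum>k=1..n - i. delta N a k (i + k) * coeff p (i + k))"
    by (rule sum.reindex_bij_witness[of _ "\<lambda>k. i + k" "\<lambda>l. l - i"]) auto
  finally have "(eigval N a n - eigval N a i) * coeff p i
      = (\<Sum>k=1..n - i. delta N a k (i + k) * coeff p (i + k))"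
    by (simp add: algebra_simps)
  then have "coeff p i = (\<Sum>k=1..n - i. delta N a k (i + k) * coeff p (i + k))
      / (eigval N a n - eigval N a i)"
    using ne by (simp add: eq_divide_eq mult.commute)
  then show ?thesis by (simp add: sum_divide_distrib)
qed

theorem theorem3:
  fixes N :: nat and a :: "nat \<Rightarrow> complex poly" and P :: "nat \<Rightarrow> complex poly"
  assumes "N \<ge> 1"
    and "\<And>m. m \<in> {1..N} \<Longrightarrow> degree (a m) \<le> m"
    and "inj (eigval N a)"
    and "\<And>n. is_monic_eigenpoly N a n (P n)"
  shows "\<forall>n\<ge>1. \<forall>i<n. coeff (P n) i =
    (\<Sum>ks\<in>compositions n i. \<Prod>s<length ks.
       delta N a (ks ! s) (i + sum_list (take (Suc s) ks)) /
       (eigval N a n - eigval N a (i + sum_list (take s ks))))"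
proof (intro allI impI)
  fix n i :: nat assume i: "i < n"
  let ?w = "\<lambda>j k. delta N a k (j + k) / (eigval N a n - eigval N a j)"
  have top: "coeff (P n) n = 1"
    using assms(4)[of n] by (auto simp: is_monic_eigenpoly_def)
  have "coeff (P n) i
      = (\<Sum>ks\<in>compositions0 (n - i). \<Prod>s<length ks. ?w (i + sum_list (take s ks)) (ks ! s))"
    using coeff_eigenpoly_recurrence[OF assms(2-4)] i
    by (intro recurrence_solution[where b = "coeff (P n)" and w = ?w] top) auto
  also have "\<dots> = (\<Sum>ks\<in>compositions n i. \<Prod>s<length ks.
       delta N a (ks ! s) (i + sum_list (take (Suc s) ks)) /
       (eigval N a n - eigval N a (i + sum_list (take s ks))))"
    unfolding compositions_eq_compositions0[OF i]
    by (intro sum.cong prod.cong refl) (simp add: take_Suc_conv_app_nth add.assoc)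
  finally show "coeff (P n) i = (\<Sum>ks\<in>compositions n i. \<Prod>s<length ks.
       delta N a (ks ! s) (i + sum_list (take (Suc s) ks)) /
       (eigval N a n - eigval N a (i + sum_list (take s ks))))" .
qed

end
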